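(* Let $k$ and $n$ be positive integers, let $P$ be a $(kn,n)$-Dyck path, and let $\sigma=(\sigma_1,\dots,\sigma_{kn+n})$ be the output sequence of the sweep map applied from right to left to $P$. Run the following algorithm on input $\sigma$, producing a sequence $\tau=(\tau_1,\dots,\tau_{kn+n})$ whose entries are initially empty: Assign $\tau_1=0$. For $i=2$ to $kn+n$: if $\tau_i$ is empty, then (a) if $\sigma_i=\mathrm{S}$, set $\tau_i=\tau_{i-1}$; (b) if $\sigma_i=\mathrm{W}$, let $x$ be the number of entries assigned so far in $\tau$ equal to $\tau_{i-1}$ minus the number of entries assigned so far in $\tau$ equal to $\tau_{i-1}-kn$ whose corresponding letter in $\sigma$ is S; if $x$ is positive, assign the level $\tau_{i-1}+n$ to the entries of $\tau$ at the positions of the next $x$ letters W in $\sigma$ (beginning with $\sigma_i$); if $x$ is negative, assign the level $\tau_{i-1}$ to the entries of $\tau$ at the positions of the next $|x|$ letters W in $\sigma$ (beginning with $\sigma_i$). If $\tau_i$ is not empty, skip to the next $i$. Then the output $\tau$ equals the sequence of levels of the sweep map, i.e. $\tau_j$ is the level of the step listed in position $j$ of the sweep map output.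
   Context: A $(kn,n)$-Dyck path is a lattice path from $(0,0)$ to $(kn,n)$ consisting of $kn$ unit east steps and $n$ unit north steps that never passes below the line $y=x/k$. The level of a lattice point $(x,y)$ is $kn\cdot y-n\cdot x$; thus the path stays at levels $\ge 0$, a north step raises the level by $kn$ and an east step lowers it by $n$. Each step is recorded by its starting point: a north step is recorded as S (its south endpoint) and an east step as W (its west endpoint); the level of a step is the level of its starting point. The sweep map applied from right to left lists all $kn+n$ steps in order of nondecreasing level, where among steps of equal level the one occurring later along the path (further to the right) is listed first. The output sequence $\sigma$ is the resulting word in the letters S and W; the associated (rank) sequence of levels lists, for each position $j$, the level of the step listed in position $j$. *)

theory Defs
  imports Complex_Main
begin

datatype step = North | East

text \<open>The starting point of step \<open>P ! i\<close>; for \<open>i = length P\<close>, the end point of the path.\<close>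
definition path_point :: "step list \<Rightarrow> nat \<Rightarrow> nat \<times> nat" where
  "path_point P i = (count_list (take i P) East, count_list (take i P) North)"

text \<open>Between consecutive lattice points the path is a segment, so it stays weakly above the
  line \<open>y = x / k\<close> iff all its lattice points do.\<close>
definition dyck_path :: "nat \<Rightarrow> nat \<Rightarrow> step list \<Rightarrow> bool" where
  "dyck_path k n P \<longleftrightarrow>
     path_point P (length P) = (k * n, n) \<and>
     (\<forall>i \<le> length P. case path_point P i of (x, y) \<Rightarrow> real y \<ge> real x / real k)"

fun level :: "nat \<Rightarrow> nat \<Rightarrow> nat \<times> nat \<Rightarrow> int" where
  "level k n (x, y) = int (k * n) * int y - int n * int x"

definition step_level :: "nat \<Rightarrow> nat \<Rightarrow> step list \<Rightarrow> nat \<Rightarrow> int" where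
  "step_level k n P i = level k n (path_point P i)"

datatype letter = S | W

fun step_letter :: "step \<Rightarrow> letter" where
  "step_letter North = S"
| "step_letter East = W"

text \<open>\<open>sort_key\<close> is stable, so starting from the reversed list of step indices puts the later of
  two steps of equal level first.\<close>
definition sweep_order :: "nat \<Rightarrow> nat \<Rightarrow> step list \<Rightarrow> nat list" where
  "sweep_order k n P = sort_key (step_level k n P) (rev [0..<length P])"

definition sweep_word :: "nat \<Rightarrow> nat \<Rightarrow> step list \<Rightarrow> letter list" where
  "sweep_word k n P = map (\<lambda>i. step_letter (P ! i)) (sweep_order k n P)"

definition sweep_levels :: "nat \<Rightarrow> nat \<Rightarrow> step list \<Rightarrow> int list" where
  "sweep_levels k n P = map (step_level k n P) (sweep_order k n P)"

text \<open>Positions in \<open>\<sigma>\<close> and \<open>\<tau>\<close> are counted from 0; an empty entry of \<open>\<tau>\<close> is \<open>None\<close>.\<close>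

definition next_Ws :: "letter list \<Rightarrow> nat \<Rightarrow> nat \<Rightarrow> nat list" where
  "next_Ws \<sigma> i m = take m (filter (\<lambda>j. \<sigma> ! j = W) [i..<length \<sigma>])"

definition assign_all :: "nat list \<Rightarrow> int \<Rightarrow> int option list \<Rightarrow> int option list" where
  "assign_all js v \<tau> = fold (\<lambda>j \<tau>. \<tau>[j := Some v]) js \<tau>"

definition excess :: "nat \<Rightarrow> nat \<Rightarrow> letter list \<Rightarrow> int option list \<Rightarrow> int \<Rightarrow> int" where
  "excess k n \<sigma> \<tau> v =
     int (card {j \<in> {..<length \<tau>}. \<tau> ! j = Some v})
     - int (card {j \<in> {..<length \<tau>}. \<tau> ! j = Some (v - int (k * n)) \<and> \<sigma> ! j = S})"

text \<open>The prescribed instructions are meaningless when the previous entry is empty, and assign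
  nothing when \<open>x = 0\<close>; in both cases \<open>\<tau>\<close> is left unchanged, so the entry stays \<open>None\<close>.\<close>
definition inverse_sweep_step ::
    "nat \<Rightarrow> nat \<Rightarrow> letter list \<Rightarrow> nat \<Rightarrow> int option list \<Rightarrow> int option list" where
  "inverse_sweep_step k n \<sigma> i \<tau> =
     (case \<tau> ! i of
        Some _ \<Rightarrow> \<tau>
      | None \<Rightarrow>
          (case \<tau> ! (i - 1) of
             None \<Rightarrow> \<tau>
           | Some v \<Rightarrow>
               (case \<sigma> ! i of
                  S \<Rightarrow> \<tau>[i := Some v]
                | W \<Rightarrow>
                    (let x = excess k n \<sigma> \<tau> v in
                     if x > 0 then assign_all (next_Ws \<sigma> i (nat x)) (v + int n) \<tau>
                     else if x < 0 then assign_all (next_Ws \<sigma> i (nat \<bar>x\<bar>)) v \<tau>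
                     else \<tau>))))"

definition inverse_sweep :: "nat \<Rightarrow> nat \<Rightarrow> letter list \<Rightarrow> int option list" where
  "inverse_sweep k n \<sigma> =
     fold (inverse_sweep_step k n \<sigma>) [1..<k * n + n] ((replicate (k * n + n) None)[0 := Some 0])"

end

theory Submission
  imports Defs
begin

text \<open>
  A Dyck path returns to level 0, so every level is left as often as it is reached. As level \<open>v\<close>
  is reached by north steps from \<open>v - kn\<close> and by east steps from \<open>v + n\<close>, the quantity \<open>x\<close>
  computed by the algorithm is exactly the number of east steps at level \<open>v + n\<close>, as soon as all
  levels up to \<open>v\<close> have been assigned correctly. Since east steps descend by \<open>n\<close>, no positive level
  below an attained one is skipped, and the last step leaving a positive level is an east step.
  Hence in the sweep order every positive level starts with a letter W, so the algorithm always
  meets an empty W exactly where a new level starts, and \<open>x\<close> is positive there.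
\<close>

section \<open>Stable sorting, list updates and counting\<close>

lemma sorted_wrt_insort_key:
  fixes f :: "'a \<Rightarrow> 'b::linorder"
  assumes "sorted_wrt (\<lambda>x y. f x < f y \<or> f x = f y \<and> R x y) ys"
    and "\<forall>y\<in>set ys. R x y"
  shows "sorted_wrt (\<lambda>x y. f x < f y \<or> f x = f y \<and> R x y) (insort_key f x ys)"
  using assms by (induction ys) (auto simp: set_insort_key)

text \<open>Stability in a usable form: \<open>insort_key\<close> puts an entry in front of all
  entries with the same key, so ties keep the order \<open>R\<close> of the input.\<close>

lemma sorted_wrt_sort_key_lex:
  fixes f :: "'a \<Rightarrow> 'b::linorder"
  assumes "sorted_wrt R xs"
  shows "sorted_wrt (\<lambda>x y. f x < f y \<or> f x = f y \<and> R x y) (sort_key f xs)"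
  using assms by (induction xs) (auto intro!: sorted_wrt_insort_key)

text \<open>Earlier entries inherit \<open>Q\<close> from later ones, so the entries with
  \<open>Q\<close> form an initial segment.\<close>

lemma take_length_filter_prefix:
  assumes "sorted_wrt (\<lambda>x y. Q y \<longrightarrow> Q x) xs"
  shows "take (length (filter Q xs)) xs = filter Q xs"
  using assms
proof (induction xs)
  case (Cons x xs)
  show ?case
  proof (cases "Q x")
    case False
    then have "filter Q xs = []" using Cons.prems by (auto simp: filter_empty_conv)
    with False show ?thesis by simp
  qed (use Cons in auto)
qed simp

text \<open>All updates write the same value, so only the set of \<open>js\<close> matters; indices
  from \<open>m\<close> on have no effect.\<close>

lemma assign_all_map:
  "assign_all js v (map f [0..<m]) = map (\<lambda>j. if j \<in> set js then Some v else f j) [0..<m]"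
proof (induction js arbitrary: f)
  case (Cons a js)
  have "(map f [0..<m])[a := Some v] = map (\<lambda>j. if j = a then Some v else f j) [0..<m]"
    by (rule nth_equalityI) (auto simp: nth_list_update)
  then have "assign_all (a # js) v (map f [0..<m])
      = assign_all js v (map (\<lambda>j. if j = a then Some v else f j) [0..<m])"
    by (simp add: assign_all_def)
  also have "\<dots> = map (\<lambda>j. if j \<in> set (a # js) then Some v else f j) [0..<m]"
    unfolding Cons.IH by auto
  finally show ?case .
qed (simp add: assign_all_def)

text \<open>Counting over the indices 1 to \<open>m\<close> instead of 0 to \<open>m - 1\<close>
  only exchanges the two end terms, which agree.\<close>

lemma card_shift_closed:
  assumes "f 0 = f m"
  shows "card {i. i < m \<and> f (Suc i) = v} = card {i. i < m \<and> f i = v}"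
proof -
  have "(\<Sum>i<m. if f (Suc i) = v then 1 else 0) + (if f 0 = v then 1 else (0::nat))
      = (\<Sum>i<m. if f i = v then 1 else 0) + (if f m = v then 1 else 0)"
    using sum.lessThan_Suc[of "\<lambda>i. if f i = v then 1 else (0::nat)" m]
      sum.lessThan_Suc_shift[of "\<lambda>i. if f i = v then 1 else (0::nat)" m] by simp
  then have "(\<Sum>i<m. if f (Suc i) = v then 1 else 0)
      = (\<Sum>i<m. if f i = v then 1 else (0::nat))"
    using assms by simp
  moreover have "(\<Sum>i<m. if p i then 1 else 0) = card {i. i < m \<and> p i}" for p :: "nat \<Rightarrow> bool"
    by (simp add: sum.If_cases Int_def)
  ultimately show ?thesis by simp
qed

section \<open>Levels along a Dyck path\<close>

locale dyck =
  fixes k n :: nat and P :: "step list"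
  assumes k_pos: "k > 0" and n_pos: "n > 0" and dyck: "dyck_path k n P"
begin

abbreviation lev where "lev \<equiv> step_level k n P"
abbreviation ord where "ord \<equiv> sweep_order k n P"
abbreviation \<sigma> where "\<sigma> \<equiv> sweep_word k n P"
abbreviation rank where "rank j \<equiv> lev (ord ! j)"

lemma length_path: "length P = k * n + n"
proof -
  have "length P = count_list P East + count_list P North"
  proof (induction P)
    case (Cons a P) then show ?case by (cases a) auto
  qed simp
  then show ?thesis using dyck by (simp add: dyck_path_def path_point_def)
qed

lemma lev_0: "lev 0 = 0"
  by (simp add: step_level_def path_point_def)

lemma lev_end: "lev (length P) = 0"
  using dyck by (simp add: step_level_def dyck_path_def)

lemma lev_Suc:
  assumes "i < length P"
  shows "lev (Suc i) = (if P ! i = North then lev i + int (k * n) else lev i - int n)"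
  using assms by (cases "P ! i")
    (auto simp: step_level_def path_point_def take_Suc_conv_app_nth algebra_simps)

lemma lev_nonneg:
  assumes "i \<le> length P"
  shows "lev i \<ge> 0"
proof -
  obtain x y where xy: "path_point P i = (x, y)" by fastforce
  then have "real y \<ge> real x / real k" using dyck assms by (force simp: dyck_path_def)
  then have "real x \<le> real (k * y)" using k_pos by (simp add: field_simps)
  then have "x \<le> k * y" by (simp only: of_nat_le_iff)
  then have "n * x \<le> k * n * y"
    by (metis mult.assoc mult.commute mult_le_mono2)
  then have "int n * int x \<le> int (k * n) * int y" by (metis of_nat_le_iff of_nat_mult)
  then show ?thesis by (simp add: step_level_def xy)
qed

lemma dvd_lev: "int n dvd lev i"
  by (cases "path_point P i") (simp add: step_level_def)

text \<open>Take the last point of level at least \<open>v\<close>. The path ends at level 0, so a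
  step leaves this point, and it goes below \<open>v\<close>; hence it is an east step.\<close>

lemma last_visit_East:
  assumes "i \<le> length P" and "lev i \<ge> v" and "v > 0" and "int n dvd v"
  obtains j where "i \<le> j" "j < length P" "lev j = v" "P ! j = East"
    "\<And>m. j < m \<Longrightarrow> m \<le> length P \<Longrightarrow> lev m < v"
proof -
  let ?A = "{m. m \<le> length P \<and> lev m \<ge> v}"
  have fin: "finite ?A" by (rule finite_subset[of _ "{..length P}"]) auto
  define j where "j = Max ?A"
  have "?A \<noteq> {}" using assms by auto
  then have j: "j \<le> length P" "lev j \<ge> v" using Max_in[OF fin] by (auto simp: j_def)
  have ij: "i \<le> j" using assms fin by (auto simp: j_def)
  have later: "lev m < v" if "j < m" "m \<le> length P" for m
    using Max_ge[OF fin, of m] that by (fastforce simp: j_def)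
  have jL: "j < length P" using j lev_end assms(3) by (cases "j = length P") auto
  have "lev (Suc j) < v" using later jL by auto
  then have E: "P ! j = East" using j lev_Suc[OF jL]
    by (cases "P ! j") (auto simp del: of_nat_mult)
  then have lt: "lev j - int n < v" using lev_Suc[OF jL] \<open>lev (Suc j) < v\<close> by simp
  \<comment> \<open>Both levels are multiples of \<open>n\<close>, and an east step from
    \<open>v + n\<close> or higher would not get below \<open>v\<close>.\<close>
  have "int n \<le> lev j - v" if "v < lev j"
    using that dvd_lev assms(4) by (intro zdvd_imp_le dvd_diff) auto
  then have "lev j = v" using lt j by linarith
  with that ij jL E later show ?thesis by blast
qed

text \<open>Departures from \<open>v\<close> are as many as arrivals, and an arrival is an east step
  from \<open>v + n\<close> or a north step from \<open>v - kn\<close>.\<close>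

lemma card_East_at:
  "int (card {i. i < length P \<and> lev i = v + int n \<and> P ! i = East})
   = int (card {i. i < length P \<and> lev i = v})
     - int (card {i. i < length P \<and> lev i = v - int (k * n) \<and> P ! i = North})"
proof -
  have "{i. i < length P \<and> lev (Suc i) = v}
      = {i. i < length P \<and> lev i = v + int n \<and> P ! i = East}
        \<union> {i. i < length P \<and> lev i = v - int (k * n) \<and> P ! i = North}" (is "_ = ?E \<union> ?N")
    by (auto simp: lev_Suc split: if_splits) (metis step.exhaust)+
  moreover have "card (?E \<union> ?N) = card ?E + card ?N"
    by (rule card_Un_disjoint) auto
  ultimately show ?thesis
    using card_shift_closed[of lev "length P" v] lev_0 lev_end by simp
qed

section \<open>Positions in the sweep order\<close>

lemma length_ord: "length ord = length P"
  by (simp add: sweep_order_def)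

lemma set_ord: "set ord = {..<length P}"
  by (auto simp: sweep_order_def)

lemma ord_less: "j < length P \<Longrightarrow> ord ! j < length P"
  using set_ord length_ord by (metis lessThan_iff nth_mem)

lemma bij_ord: "bij_betw ((!) ord) {..<length P} {..<length P}"
  using bij_betw_nth[of ord "{..<length P}" "{..<length P}"] length_ord set_ord
  by (simp add: sweep_order_def)

lemma ord_lex:
  assumes "a < b" "b < length P"
  shows "rank a < rank b \<or> rank a = rank b \<and> ord ! b < ord ! a"
proof -
  have "sorted_wrt (\<lambda>x y. y < x) (rev [0..<length P])"
    by (simp add: sorted_wrt_rev)
  from sorted_wrt_sort_key_lex[OF this, of lev] assms show ?thesis
    unfolding sweep_order_def[symmetric] by (simp add: sorted_wrt_iff_nth_less length_ord)
qed

lemma rank_mono: "a \<le> b \<Longrightarrow> b < length P \<Longrightarrow> rank a \<le> rank b"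
  using ord_lex[of a b] by (cases "a = b") auto

lemma rank_nonneg: "j < length P \<Longrightarrow> rank j \<ge> 0"
  using lev_nonneg ord_less by (simp add: less_imp_le)

lemma obtain_position:
  assumes "i < length P" obtains j where "j < length P" "ord ! j = i"
  using assms set_ord length_ord by (metis in_set_conv_nth lessThan_iff)

lemma length_\<sigma>: "length \<sigma> = length P"
  by (simp add: sweep_word_def length_ord)

lemma \<sigma>_eq_W: "j < length P \<Longrightarrow> \<sigma> ! j = W \<longleftrightarrow> P ! (ord ! j) = East"
  by (cases "P ! (ord ! j)") (auto simp: sweep_word_def length_ord)

lemma \<sigma>_eq_S: "j < length P \<Longrightarrow> \<sigma> ! j = S \<longleftrightarrow> P ! (ord ! j) = North"
  by (cases "P ! (ord ! j)") (auto simp: sweep_word_def length_ord)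

lemma length_pos: "0 < length P"
  using length_path n_pos by simp

lemma rank_0: "rank 0 = 0"
proof -
  obtain j where "j < length P" "ord ! j = 0" using obtain_position length_pos by blast
  then show ?thesis using rank_mono[of 0 j] rank_nonneg[OF length_pos] lev_0 by simp
qed

text \<open>An east step from level 0 would end at level \<open>-n\<close>.\<close>

lemma no_W_at_level_0: "j < length P \<Longrightarrow> rank j = 0 \<Longrightarrow> \<sigma> ! j \<noteq> W"
  using lev_Suc[of "ord ! j"] lev_nonneg[of "Suc (ord ! j)"] ord_less[of j] n_pos
  by (auto simp: \<sigma>_eq_W)

lemma new_level:
  assumes "i > 0" "i < length P" "rank i \<noteq> rank (i - 1)"
  shows "rank i = rank (i - 1) + int n" and "\<sigma> ! i = W"
proof -
  have less: "rank (i - 1) < rank i" using rank_mono[of "i - 1" i] assms by simp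
  have pos: "0 < rank i" using less rank_nonneg[of "i - 1"] assms by linarith
  have "int n \<le> rank i - rank (i - 1)"
    using less dvd_lev by (intro zdvd_imp_le dvd_diff) auto
  moreover have "0 < rank (i - 1) + int n" using rank_nonneg[of "i - 1"] assms n_pos by linarith
  moreover have "int n dvd rank (i - 1) + int n" using dvd_lev by simp
  \<comment> \<open>The step at position \<open>i\<close> starts at or above
    \<open>rank (i - 1) + n\<close>, so the path later leaves that level; the position of this
    departure bounds \<open>rank i\<close> from above.\<close>
  ultimately obtain j where j: "j < length P" "lev j = rank (i - 1) + int n"
    using last_visit_East[of "ord ! i" "rank (i - 1) + int n"] ord_less[of i] assms
    by (smt (verit) less_imp_le)
  obtain m where m: "m < length P" "ord ! m = j" using j obtain_position by blast
  have "\<not> m \<le> i - 1" using rank_mono[of m "i - 1"] m j assms n_pos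
    by (smt (verit) diff_le_self le_less_trans of_nat_0_less_iff)
  then have "rank i \<le> rank m" using rank_mono[of i m] m assms by simp
  with m j \<open>int n \<le> rank i - rank (i - 1)\<close> show "rank i = rank (i - 1) + int n" by simp
  obtain j where j: "ord ! i \<le> j" "j < length P" "lev j = rank i" "P ! j = East"
    using last_visit_East[of "ord ! i" "rank i"] ord_less[of i] assms pos dvd_lev
    by (metis less_imp_le order_refl)
  obtain m where m: "m < length P" "ord ! m = j" using j obtain_position by blast
  have "\<not> m \<le> i - 1" using rank_mono[of m "i - 1"] m j assms less
    by (smt (verit) diff_le_self le_less_trans)
  \<comment> \<open>Among equal levels the later step is listed first, so a position
    \<open>m\<close> after \<open>i\<close> would give \<open>j < ord ! i\<close>.\<close>
  then have "m = i" using ord_lex[of i m] m j by (cases "i < m") auto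
  then show "\<sigma> ! i = W" using j(4) m by (simp add: \<sigma>_eq_W)
qed

section \<open>Counting over positions, and the invariant of the algorithm\<close>

lemma card_positions:
  "card {j. j < length P \<and> Q (ord ! j)} = card {i. i < length P \<and> Q i}"
proof (rule bij_betw_same_card)
  show "bij_betw ((!) ord) {j. j < length P \<and> Q (ord ! j)} {i. i < length P \<and> Q i}"
    using bij_betw_Collect[OF bij_ord, of Q "\<lambda>j. Q (ord ! j)"] by simp
qed

text \<open>The invariant: the array after position \<open>i\<close> has been processed.\<close>
definition state :: "nat \<Rightarrow> int option list" where
  "state i = map (\<lambda>j. if j \<le> i \<or> \<sigma> ! j = W \<and> rank j = rank i then Some (rank j) else None)
     [0..<length P]"

text \<open>Every position from \<open>i\<close> on has a level above \<open>rank (i - 1)\<close>,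
  so no entry has been filled in ahead.\<close>

lemma state_before_new_level:
  assumes "i > 0" "i < length P" "rank i \<noteq> rank (i - 1)"
  shows "state (i - 1) = map (\<lambda>j. if j < i then Some (rank j) else None) [0..<length P]"
proof -
  have "rank j \<noteq> rank (i - 1)" if "i \<le> j" "j < length P" for j
    using rank_mono[of i j] rank_mono[of "i - 1" i] assms that by simp
  then show ?thesis using assms by (force simp: state_def)
qed

text \<open>All steps of level at most \<open>rank (i - 1)\<close> are listed before
  \<open>i\<close>, so both counts in the partly filled array are counts over the whole path, where
  \<open>card_East_at\<close> applies.\<close>

lemma excess_new_level:
  assumes "i > 0" "i < length P" "rank i \<noteq> rank (i - 1)"
  shows "excess k n \<sigma> (state (i - 1)) (rank (i - 1))
    = int (card {j. j < length P \<and> rank j = rank i \<and> \<sigma> ! j = W})"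
proof -
  let ?v = "rank (i - 1)"
  have before: "j < i" if "j < length P" "rank j \<le> ?v" for j
    using rank_mono[of i j] rank_mono[of "i - 1" i] assms that by force
  have "{j \<in> {..<length (state (i - 1))}. state (i - 1) ! j = Some ?v}
      = {j. j < length P \<and> rank j = ?v}"
    using before unfolding state_before_new_level[OF assms] by (auto split: if_splits)
  moreover have "{j \<in> {..<length (state (i - 1))}.
        state (i - 1) ! j = Some (?v - int (k * n)) \<and> \<sigma> ! j = S}
      = {j. j < length P \<and> rank j = ?v - int (k * n) \<and> P ! (ord ! j) = North}"
    using before unfolding state_before_new_level[OF assms]
    by (auto simp: \<sigma>_eq_S split: if_splits)
  moreover have "{j. j < length P \<and> rank j = rank i \<and> \<sigma> ! j = W}
      = {j. j < length P \<and> rank j = ?v + int n \<and> P ! (ord ! j) = East}"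
    using new_level(1)[OF assms] by (auto simp: \<sigma>_eq_W)
  ultimately show ?thesis
    unfolding excess_def
    using card_East_at[of ?v] card_positions[of "\<lambda>i. lev i = ?v"]
      card_positions[of "\<lambda>i. lev i = ?v - int (k * n) \<and> P ! i = North"]
      card_positions[of "\<lambda>i. lev i = ?v + int n \<and> P ! i = East"]
    by simp
qed

text \<open>The level \<open>rank i\<close> starts at \<open>i\<close> and levels do not decrease,
  so from \<open>i\<close> on its letters W come before all other letters W.\<close>

lemma next_Ws_new_level:
  assumes "i > 0" "i < length P" "rank i \<noteq> rank (i - 1)"
  shows "set (next_Ws \<sigma> i (card {j. j < length P \<and> rank j = rank i \<and> \<sigma> ! j = W}))
    = {j. j < length P \<and> rank j = rank i \<and> \<sigma> ! j = W}" (is "set (next_Ws _ _ (card ?A)) = _")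
proof -
  let ?xs = "filter (\<lambda>j. \<sigma> ! j = W) [i..<length P]"
  let ?Q = "\<lambda>j. rank j = rank i"
  have "i \<le> j" if "j < length P" "rank j = rank i" for j
    using rank_mono[of j "i - 1"] rank_mono[of "i - 1" i] assms that by force
  then have A: "set (filter ?Q ?xs) = ?A" by auto
  have "?Q a" if "i \<le> a" "a < b" "b < length P" "?Q b" for a b
    using rank_mono[of i a] rank_mono[of a b] that by linarith
  then have "sorted_wrt (\<lambda>x y. ?Q y \<longrightarrow> ?Q x) [i..<length P]"
    by (intro sorted_wrt_mono_rel[OF _ sorted_wrt_upt]) auto
  then have "take (length (filter ?Q ?xs)) ?xs = filter ?Q ?xs"
    by (intro take_length_filter_prefix sorted_wrt_filter)
  moreover have "length (filter ?Q ?xs) = card ?A"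
    unfolding A[symmetric] by (rule distinct_card[symmetric]) simp
  ultimately show ?thesis using A by (simp add: next_Ws_def length_\<sigma>)
qed

text \<open>Inside a level, an S copies the previous entry and a W was filled when the level began;
  at a new level all its letters W are filled at once.\<close>

lemma inverse_sweep_step_state:
  assumes "i > 0" "i < length P"
  shows "inverse_sweep_step k n \<sigma> i (state (i - 1)) = state i"
proof (cases "rank i = rank (i - 1)")
  case same: True
  have prev: "state (i - 1) ! (i - 1) = Some (rank (i - 1))" using assms by (simp add: state_def)
  show ?thesis
  proof (cases "\<sigma> ! i")
    case S
    have "state (i - 1) ! i = None" using assms S by (simp add: state_def)
    moreover have "(state (i - 1))[i := Some (rank (i - 1))] = state i"
      using assms same by (intro nth_equalityI) (auto simp: state_def nth_list_update)
    ultimately show ?thesis using S prev by (simp add: inverse_sweep_step_def)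
  next
    case W
    have "state (i - 1) ! i = Some (rank i)" using assms W same by (simp add: state_def)
    moreover have "state (i - 1) = state i"
      using assms same W by (intro nth_equalityI) (auto simp: state_def le_less)
    ultimately show ?thesis by (simp add: inverse_sweep_step_def)
  qed
next
  case new: False
  note new' = assms new
  let ?A = "{j. j < length P \<and> rank j = rank i \<and> \<sigma> ! j = W}"
  have st: "state (i - 1) ! i = None" "state (i - 1) ! (i - 1) = Some (rank (i - 1))"
    using assms unfolding state_before_new_level[OF new'] by auto
  \<comment> \<open>This makes \<open>x\<close> positive, which selects the branch assigning
    \<open>rank (i - 1) + n\<close>, that is, \<open>rank i\<close>.\<close>
  have "i \<in> ?A" using assms new_level(2)[OF new'] by simp
  then have "card ?A > 0" by (auto simp: card_gt_0_iff)
  then have "inverse_sweep_step k n \<sigma> i (state (i - 1))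
      = assign_all (next_Ws \<sigma> i (card ?A)) (rank i) (state (i - 1))"
    using st new_level[OF new'] excess_new_level[OF new']
    by (simp add: inverse_sweep_step_def)
  also have "\<dots> = map (\<lambda>j. if j \<in> ?A then Some (rank i)
      else if j < i then Some (rank j) else None) [0..<length P]"
    unfolding state_before_new_level[OF new'] assign_all_map next_Ws_new_level[OF new'] ..
  also have "\<dots> = state i"
    using \<open>i \<in> ?A\<close> by (intro nth_equalityI) (auto simp: state_def)
  finally show ?thesis .
qed

lemma fold_inverse_sweep_step:
  "i < length P \<Longrightarrow> fold (inverse_sweep_step k n \<sigma>) [1..<Suc i] (state 0) = state i"
proof (induction i)
  case (Suc i)
  then show ?case using inverse_sweep_step_state[of "Suc i"] by simp
qed simp

lemma inverse_sweep_sweep_word: "inverse_sweep k n \<sigma> = map Some (sweep_levels k n P)"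
proof -
  \<comment> \<open>Beyond position 0, \<open>state 0\<close> could only fill letters W of level 0,
    and there are none.\<close>
  have "(replicate (length P) None)[0 := Some 0] = state 0"
    using rank_0 no_W_at_level_0
    by (intro nth_equalityI) (auto simp: state_def nth_list_update)
  then have "inverse_sweep k n \<sigma> = state (length P - 1)"
    using fold_inverse_sweep_step[of "length P - 1"] length_pos
    by (simp add: inverse_sweep_def del: upt_Suc flip: length_path)
  also have "\<dots> = map Some (sweep_levels k n P)"
    by (intro nth_equalityI) (auto simp: state_def sweep_levels_def length_ord)
  finally show ?thesis .
qed

end

theorem theorem2p2:
  fixes k n :: nat and P :: "step list"
  assumes "k > 0" and "n > 0" and "dyck_path k n P"
  shows "inverse_sweep k n (sweep_word k n P) = map Some (sweep_levels k n P)"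
  using dyck.inverse_sweep_sweep_word[OF dyck.intro[OF assms]] .

end
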